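(* Let $D(t)\in\mathbb{Q}[t]$ be a nonconstant polynomial whose Pell equation has a fundamental solution $(u,v)$ with $u,v\in\mathbb{Q}[t]$. Let $n>3$ be an integer and suppose that $v^{\mathrm{new}}_n(t)$ has a repeated root $\alpha\in\mathbb{C}$ whose degree $d_\alpha=[\mathbb{Q}(\alpha):\mathbb{Q}]$ is an odd prime. Then either $n=2d_\alpha+1$ and $n$ is prime, or $n=9$, in which case $\alpha$ is cubic (i.e. $d_\alpha=3$).
   Context: For $D$ nonconstant, Pell's equation for $D$ is $x^2-Dy^2=1$ with $x,y\in\mathbb{C}[t]$. A fundamental solution is a solution $(u,v)$ with $v\neq 0$ of minimal degree among all solutions with $y\neq0$. For integers $n\geq 1$ define $u_n,v_n$ by $u_n+v_n\sqrt{D}=(u+v\sqrt{D})^n$. The "new part" $v^{\mathrm{new}}_n$ of $v_n$ is the polynomial determined by $v_n=\prod_{m\mid n}v^{\mathrm{new}}_m$ for all $n\geq 1$; equivalently $v^{\mathrm{new}}_n=\prod_{m\mid n}v_m^{\mu(n/m)}$, where $\mu$ is the Möbius function. A repeated root is a root of multiplicity at least $2$. *)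

theory Defs
  imports Complex_Main "HOL-Computational_Algebra.Computational_Algebra"
begin

definition pell_solution :: "'a::comm_ring_1 poly \<Rightarrow> 'a poly \<Rightarrow> 'a poly \<Rightarrow> bool" where
  "pell_solution D x y \<longleftrightarrow> x\<^sup>2 - D * y\<^sup>2 = 1"

text \<open>The degree of a solution is read as the degree of \<open>x\<close>; by
  \<open>pell_solution_degree\<close> minimising the degree of \<open>y\<close> instead gives the same notion.\<close>

definition fundamental_solution :: "complex poly \<Rightarrow> complex poly \<Rightarrow> complex poly \<Rightarrow> bool" where
  "fundamental_solution D u v \<longleftrightarrow>
     pell_solution D u v \<and> v \<noteq> 0 \<and>
     (\<forall>x y. pell_solution D x y \<and> y \<noteq> 0 \<longrightarrow> degree u \<le> degree x)"

lemma pell_solution_degree: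
  fixes D x y :: "'a::idom poly"
  assumes "pell_solution D x y" "y \<noteq> 0" "degree D > 0"
  shows "2 * degree x = degree D + 2 * degree y"
proof -
  have nz: "D \<noteq> 0" using assms(3) by auto
  have "x\<^sup>2 = D * y\<^sup>2 + 1"
    using assms(1) by (simp add: pell_solution_def algebra_simps)
  moreover have "degree (D * y\<^sup>2) = degree D + 2 * degree y"
    using nz assms(2) by (simp add: degree_mult_eq degree_power_eq)
  moreover from this have "degree (D * y\<^sup>2 + 1) = degree (D * y\<^sup>2)"
    using assms(3) by (intro degree_add_eq_left) simp
  moreover have "degree (x\<^sup>2) = 2 * degree x"
    by (cases "x = 0") (simp_all add: degree_power_eq)
  ultimately show ?thesis by simp
qed

text \<open>The pair \<open>(u\<^sub>n, v\<^sub>n)\<close>: coordinates of \<open>(u + v \<surd>D)\<^sup>n\<close> with respect to \<open>1, \<surd>D\<close>.\<close>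

fun pell_pow :: "'a::comm_ring_1 poly \<Rightarrow> 'a poly \<Rightarrow> 'a poly \<Rightarrow> nat \<Rightarrow> 'a poly \<times> 'a poly" where
  "pell_pow D u v 0 = (1, 0)"
| "pell_pow D u v (Suc n) =
     (let (a, b) = pell_pow D u v n in (u * a + D * v * b, u * b + v * a))"

lemma pell_pow_eval:
  fixes D u v :: "'a::comm_ring_1 poly"
  assumes "s\<^sup>2 = poly D z"
  shows "poly (fst (pell_pow D u v n)) z + poly (snd (pell_pow D u v n)) z * s
           = (poly u z + poly v z * s) ^ n"
proof (induction n)
  case 0
  then show ?case by simp
next
  case (Suc n)
  then show ?case
    unfolding pell_pow.simps power_Suc Suc.IH[symmetric]
    by (simp add: case_prod_beta Let_def assms[symmetric] algebra_simps power2_eq_square)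
qed

definition pell_v :: "'a::comm_ring_1 poly \<Rightarrow> 'a poly \<Rightarrow> 'a poly \<Rightarrow> nat \<Rightarrow> 'a poly" where
  "pell_v D u v n = snd (pell_pow D u v n)"

text \<open>A factorisation determines \<open>w n\<close> only for \<open>n \<ge> 1\<close>, so the definite description
  ranges over the value at \<open>n\<close> rather than over the whole sequence \<open>w\<close>.\<close>

definition pell_v_new :: "'a::comm_ring_1 poly \<Rightarrow> 'a poly \<Rightarrow> 'a poly \<Rightarrow> nat \<Rightarrow> 'a poly" where
  "pell_v_new D u v n =
     (THE p. \<exists>w. (\<forall>k\<ge>1. pell_v D u v k = (\<Prod>m | m dvd k. w m)) \<and> w n = p)"

definition complex_subfield :: "complex set \<Rightarrow> bool" where
  "complex_subfield K \<longleftrightarrow>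
     1 \<in> K \<and> (\<forall>x\<in>K. \<forall>y\<in>K. x - y \<in> K \<and> x * y \<in> K) \<and> (\<forall>x\<in>K. inverse x \<in> K)"

definition rat_adjoin :: "complex \<Rightarrow> complex set" where
  "rat_adjoin \<alpha> = complex_subfield hull {\<alpha>}"

text \<open>The dimension of \<open>\<rat>(\<alpha>)\<close> as a rational vector space; it is \<open>0\<close> when \<open>\<alpha>\<close> is transcendental.\<close>

definition rat_degree :: "complex \<Rightarrow> nat" where
  "rat_degree \<alpha> = vector_space.dim (\<lambda>(q::rat) z. of_rat q * z) (rat_adjoin \<alpha>)"

lemma vector_space_rat_complex: "vector_space (\<lambda>(q::rat) (z::complex). of_rat q * z)"
  by unfold_locales (simp_all add: algebra_simps of_rat_add of_rat_mult)

end

theory Submission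
  imports Defs "HOL-Computational_Algebra.Field_as_Ring" "HOL-Number_Theory.Totient"
begin

text \<open>Since \<open>v\<^sub>n = v U\<^sub>n\<^sub>-\<^sub>1(u)\<close> for the Chebyshev polynomials \<open>U\<close> of the second kind, the roots of the
  new part for \<open>n > 1\<close> are the solutions of \<open>u(t) = cos (k \<pi> / n)\<close> with \<open>k\<close> coprime to \<open>n\<close>.  Hence
  \<open>\<rat>(cos (k \<pi> / n)) \<subseteq> \<rat>(\<alpha>)\<close>, and the degree of the left field, which is \<open>\<phi>(N) / 2\<close> for
  \<open>N\<close> the order of the root of unity \<open>exp(i k \<pi> / n)\<close>, divides the odd prime \<open>d\<^sub>\<alpha>\<close>.  Elementary
  number theory leaves only the two cases.\<close>

section \<open>Evaluation of polynomials\<close>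

text \<open>\<open>rat_degree\<close> is the dimension of a field hull, so two bridges carry the
  argument: the dimension of a subfield divides that of the field, and the degree of an irreducible
  polynomial is the dimension generated by its root. The value \<open>totient N / 2\<close> then
  becomes a count of the roots of the minimal polynomial of (z + 1/z)/2. That count needs all
  primitive N-th roots of unity to be conjugate, in effect the irreducibility of the cyclotomic
  polynomial; Landau's argument gets this from congruences modulo primes and a bound on
  denominators. Oddness of the degree of \<alpha> drives the arithmetic:
  \<open>totient N / 2\<close> divides an odd prime, hence is odd, and few totients are even but not
  divisible by 4.\<close>

locale coeff_hom =
  fixes h :: "'a::idom \<Rightarrow> complex"
  assumes hom_0 [simp]: "h 0 = 0" and hom_1 [simp]: "h 1 = 1"
    and hom_add: "h (x + y) = h x + h y" and hom_mult: "h (x * y) = h x * h y"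
begin

abbreviation ev :: "'a poly \<Rightarrow> complex \<Rightarrow> complex" where
  "ev p z \<equiv> poly (map_poly h p) z"

lemma ev_pCons [simp]: "ev (pCons a p) z = h a + z * ev p z"
  by (simp add: map_poly_pCons)

lemma ev_add [simp]: "ev (p + q) z = ev p z + ev q z"
  by (induction p q rule: poly_induct2) (simp_all add: hom_add algebra_simps)

lemma ev_diff [simp]: "ev (p - q) z = ev p z - ev q z"
proof -
  have "ev p z = ev (p - q) z + ev q z"
    using ev_add[of "p - q" q z] by simp
  then show ?thesis by simp
qed

lemma ev_smult [simp]: "ev (smult a p) z = h a * ev p z"
  by (induction p) (simp_all add: hom_mult algebra_simps)

lemma ev_mult [simp]: "ev (p * q) z = ev p z * ev q z"
  by (induction p) (simp_all add: algebra_simps)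

lemma ev_power [simp]: "ev (p ^ k) z = ev p z ^ k"
  by (induction k) simp_all

lemma ev_of_nat [simp]: "ev (of_nat k) z = of_nat k"
  by (induction k) simp_all

lemma ev_monom [simp]: "ev (monom a k) z = h a * z ^ k"
  by (simp add: map_poly_monom poly_monom)

lemma ev_pcompose [simp]: "ev (pcompose p q) z = ev p (ev q z)"
  by (induction p) (simp_all add: pcompose_pCons)

end

interpretation int_coeffs: coeff_hom of_int
  by unfold_locales simp_all

interpretation rat_coeffs: coeff_hom of_rat
  by unfold_locales (simp_all add: of_rat_add of_rat_mult)

lemma degree_map_poly_of_rat [simp]:
  "degree (map_poly of_rat p :: complex poly) = degree p"
  by (simp add: degree_map_poly)

section \<open>Frobenius congruences modulo a prime\<close>

lemma prime_dvd_binomial_power: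
  fixes a b :: "'a::comm_ring_1"
  assumes "prime p"
  shows "of_nat p dvd (a + b) ^ p - (a ^ p + b ^ p)"
proof -
  have p0: "p > 0" using assms prime_gt_0_nat by blast
  have "(a + b) ^ p = (\<Sum>k\<in>{..p}. of_nat (p choose k) * a ^ k * b ^ (p - k))"
    by (rule binomial_ring)
  also have "{..p} = insert 0 (insert p {1..<p})"
    using p0 by auto
  also have "(\<Sum>k\<in>insert 0 (insert p {1..<p}). of_nat (p choose k) * a ^ k * b ^ (p - k))
      = b ^ p + (a ^ p + (\<Sum>k\<in>{1..<p}. of_nat (p choose k) * a ^ k * b ^ (p - k)))"
    using p0 by simp
  finally have "(a + b) ^ p - (a ^ p + b ^ p)
      = (\<Sum>k\<in>{1..<p}. of_nat (p choose k) * a ^ k * b ^ (p - k))"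
    by simp
  also have "of_nat p dvd \<dots>"
  proof (rule dvd_sum)
    fix k assume "k \<in> {1..<p}"
    then have "p dvd (p choose k)"
      using dvd_choose_prime[of k p] assms by auto
    then have "of_nat p dvd (of_nat (p choose k) :: 'a)"
      by (metis dvd_def of_nat_mult)
    then show "of_nat p dvd of_nat (p choose k) * a ^ k * b ^ (p - k)"
      by (simp add: mult.assoc)
  qed
  finally show ?thesis .
qed

lemma int_fermat:
  fixes a :: int
  assumes "prime p"
  shows "int p dvd a ^ p - a"
proof -
  have p0: "p > 0" using assms prime_gt_0_nat by blast
  have nat: "int p dvd int n ^ p - int n" for n
  proof (induction n)
    case 0
    then show ?case using p0 by (simp add: zero_power)
  next
    case (Suc n)
    have "int p dvd (int n + 1) ^ p - (int n ^ p + 1 ^ p)"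
      using prime_dvd_binomial_power[OF assms, of "int n" 1] by simp
    from dvd_add[OF this Suc.IH] show ?case
      by (simp add: algebra_simps)
  qed
  obtain n where n: "a mod int p = int n"
    using p0 by (metis of_nat_0_less_iff pos_mod_sign zero_le_imp_eq_int)
  have c: "[a = int n] (mod int p)"
    unfolding n[symmetric] by (simp add: cong_def)
  have "[a ^ p - a = int n ^ p - int n] (mod int p)"
    by (intro cong_diff cong_pow c)
  with nat[of n] show ?thesis
    by (simp add: cong_dvd_iff)
qed

text \<open>Modulo \<open>p\<close>, raising to the power \<open>p\<close> is additive and fixes
  integer constants by Fermat, so it only replaces X by X^p. The induction peels off one coefficient
  at a time.\<close>

lemma int_poly_frobenius:
  fixes g :: "int poly"
  assumes "prime p"
  obtains r where "pcompose g (monom 1 p) = g ^ p + of_nat p * r"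
proof -
  have "of_nat p dvd pcompose g (monom 1 p) - g ^ p"
  proof (induction g)
    case 0
    have "p > 0" using assms prime_gt_0_nat by blast
    then show ?case by (simp add: zero_power)
  next
    case (pCons a g)
    have "[:a:] ^ p = [:a ^ p:]" by (induction p) simp_all
    moreover obtain c where "a ^ p - a = int p * c"
      using int_fermat[OF assms, of a] by (auto simp: dvd_def)
    ultimately have "[:a:] ^ p - [:a:] = of_nat p * [:c:]"
      by (simp add: of_nat_poly)
    then have 1: "of_nat p dvd [:a:] ^ p - [:a:]" by (metis dvd_triv_left)
    have 2: "of_nat p dvd (pcompose g (monom 1 p) - g ^ p) * monom 1 p"
      using pCons.IH by simp
    have 3: "of_nat p dvd ([:a:] + monom 1 1 * g) ^ p - ([:a:] ^ p + (monom 1 1 * g) ^ p)"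
      by (rule prime_dvd_binomial_power[OF assms])
    have eq: "pCons a g = [:a:] + monom 1 1 * g"
      by (simp add: monom_Suc)
    have mp: "(monom 1 1 * g) ^ p = monom 1 p * g ^ p"
      by (simp add: power_mult_distrib monom_power)
    have "pcompose (pCons a g) (monom 1 p) - pCons a g ^ p
        = (pcompose g (monom 1 p) - g ^ p) * monom 1 p - ([:a:] ^ p - [:a:])
          - (([:a:] + monom 1 1 * g) ^ p - ([:a:] ^ p + (monom 1 1 * g) ^ p))"
      unfolding mp unfolding eq[symmetric] by (simp add: pcompose_pCons algebra_simps)
    with 1 2 3 show ?case by (simp only: dvd_diff)
  qed
  then obtain r where "pcompose g (monom 1 p) - g ^ p = of_nat p * r"
    by (auto simp: dvd_def)
  then have "pcompose g (monom 1 p) = g ^ p + of_nat p * r"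
    by (metis add.commute diff_add_cancel)
  then show ?thesis using that by blast
qed

section \<open>Conjugates of roots of unity\<close>

interpretation rat_vs: vector_space "\<lambda>(q::rat) (z::complex). of_rat q * z"
  by (rule vector_space_rat_complex)

lemma common_denominator:
  fixes S :: "rat set"
  assumes "finite S"
  obtains e :: nat where "e > 0" "\<And>s. s \<in> S \<Longrightarrow> of_nat e * s \<in> \<int>"
proof -
  have "\<exists>e::nat. e > 0 \<and> (\<forall>s\<in>S. of_nat e * s \<in> \<int>)"
    using assms
  proof induction
    case empty
    show ?case by (intro exI[of _ 1]) simp
  next
    case (insert s S)
    then obtain e where e: "e > 0" "\<forall>s\<in>S. of_nat e * s \<in> \<int>" by blast
    obtain a b where ab: "s = Rat.Fract a b" "b > 0" by (cases s) auto
    have "of_int b * s = of_int a"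
      using ab by (simp add: Fract_of_int_quotient)
    moreover have "of_nat (nat b) = (of_int b :: rat)" using ab(2) by simp
    ultimately have 1: "of_nat (nat b) * s \<in> \<int>" by (metis Ints_of_int)
    have "of_nat (e * nat b) * t \<in> \<int>" if "t \<in> insert s S" for t
    proof (cases "t = s")
      case True
      have "of_nat (e * nat b) * t = of_nat e * (of_nat (nat b) * s)"
        by (simp only: of_nat_mult mult.assoc True)
      also have "\<dots> \<in> \<int>" by (intro Ints_mult Ints_of_nat 1)
      finally show ?thesis .
    next
      case False
      have "of_nat (e * nat b) * t = of_nat (nat b) * (of_nat e * t)"
        by (simp only: of_nat_mult mult_ac)
      also have "\<dots> \<in> \<int>" by (rule Ints_mult[OF Ints_of_nat], use that False e(2) in blast)
      finally show ?thesis .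
    qed
    moreover have "e * nat b > 0" using e(1) ab(2) by simp
    ultimately show ?case by blast
  qed
  with that show ?thesis by blast
qed

text \<open>This reduces all powers of \<open>z\<close> to finitely many, so that finitely many
  denominators and bounds suffice later.\<close>

lemma root_of_unity_power_mod:
  fixes z :: "'a::monoid_mult"
  assumes "z ^ N = 1"
  shows "z ^ k = z ^ (k mod N)"
proof -
  have "z ^ k = z ^ (N * (k div N) + k mod N)" by simp
  also have "\<dots> = z ^ (k mod N)" by (simp only: power_add power_mult assms) simp
  finally show ?thesis .
qed

text \<open>A rational linear functional sending \<open>x\<close> to \<open>1\<close> maps \<open>\<int>[z]\<close> into \<open>(1/e)\<int>\<close> for some \<open>e\<close>.\<close>

lemma root_of_unity_ring_divisors:
  fixes z x :: complex
  assumes "z ^ N = 1" "N > 0" "x \<noteq> 0"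
  obtains e :: nat where "e > 0" "\<And>p g. x = of_nat p * int_coeffs.ev g z \<Longrightarrow> p dvd e"
proof -
  interpret pair: vector_space_pair "\<lambda>(q::rat) (z::complex). of_rat q * z" "(*) :: rat \<Rightarrow> rat \<Rightarrow> rat"
    by unfold_locales (simp_all add: algebra_simps)
  have "rat_vs.independent {x}" using assms(3) by simp
  from pair.linear_independent_extend[OF this, of "\<lambda>_. 1"]
  obtain l where lin: "Vector_Spaces.linear (\<lambda>(q::rat) (z::complex). of_rat q * z) (*) l" and lx: "l x = 1"
    by auto
  interpret l: Vector_Spaces.linear "\<lambda>(q::rat) (z::complex). of_rat q * z" "(*)" l by (rule lin)
  obtain e where e: "e > 0" "\<And>s. s \<in> (\<lambda>i. l (z ^ i)) ` {..<N} \<Longrightarrow> of_nat e * s \<in> \<int>"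
    using common_denominator[of "(\<lambda>i. l (z ^ i)) ` {..<N}"] by (metis finite_imageI finite_lessThan)
  have pow: "of_nat e * l (z ^ i) \<in> \<int>" for i
    using e(2)[of "l (z ^ (i mod N))"] assms(2) root_of_unity_power_mod[OF assms(1), of i] by simp
  show ?thesis
  proof (rule that[OF e(1)])
    fix p g assume x: "x = of_nat p * int_coeffs.ev g z"
    have "int_coeffs.ev g z = (\<Sum>i\<le>degree g. of_rat (of_int (coeff g i)) * z ^ i)"
      by (simp add: poly_altdef coeff_map_poly degree_map_poly)
    then have "l (int_coeffs.ev g z) = (\<Sum>i\<le>degree g. of_int (coeff g i) * l (z ^ i))"
      by (simp only: l.sum l.scale)
    then have "of_nat e * l (int_coeffs.ev g z)
        = of_nat e * (\<Sum>i\<le>degree g. of_int (coeff g i) * l (z ^ i))"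
      by (rule arg_cong)
    also have "\<dots> = (\<Sum>i\<le>degree g. of_int (coeff g i) * (of_nat e * l (z ^ i)))"
      unfolding sum_distrib_left by (rule sum.cong[OF refl]) (rule mult.left_commute)
    also have "\<dots> \<in> \<int>"
      by (intro Ints_sum Ints_mult pow) simp
    finally obtain t where t: "of_nat e * l (int_coeffs.ev g z) = of_int t"
      by (auto elim: Ints_cases)
    \<comment> \<open>Writing \<open>p\<close> as a rational scalar makes linearity of
      \<open>l\<close> applicable: 1 = p l(g(z)), and multiplying by \<open>e\<close> turns the
      second factor into an integer.\<close>
    have "x = of_rat (of_nat p) * int_coeffs.ev g z" by (simp add: x)
    then have "1 = of_nat p * l (int_coeffs.ev g z)"
      unfolding lx[symmetric] by (simp only: l.scale)
    then have "of_nat e = of_nat p * (of_nat e * l (int_coeffs.ev g z))"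
      by (metis mult.left_commute mult.right_neutral)
    also have "\<dots> = of_int (int p * t)" by (simp add: t)
    finally have "int e = int p * t"
      by (metis of_int_eq_iff of_int_of_nat_eq)
    then have "int p dvd int e" by simp
    then show "p dvd e" by simp
  qed
qed

text \<open>Landau's argument: \<open>g(z^m) = 0\<close> gives \<open>g(z^(pm)) \<in> p\<int>[z]\<close>, and a nonzero element
  of the finite set of all \<open>g(z^j)\<close> lies there only for boundedly many \<open>p\<close>.  Every residue coprime to
  \<open>N\<close> contains an \<open>m\<close> free of small primes.\<close>

lemma int_poly_root_of_unity_conjugate:
  fixes z :: complex
  assumes z: "z ^ N = 1" and N: "N > 0" and g: "int_coeffs.ev g z = 0" and m: "coprime m N"
  shows "int_coeffs.ev g (z ^ m) = 0"
proof -
  \<comment> \<open>Where g(z^j) = 0 the claim is vacuous; stating it for every \<open>j\<close>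
    allows a single choice function \<open>e\<close>.\<close>
  have "\<exists>e>0. \<forall>p r. int_coeffs.ev g (z ^ j) \<noteq> 0 \<longrightarrow>
      int_coeffs.ev g (z ^ j) = of_nat p * int_coeffs.ev r z \<longrightarrow> p dvd (e::nat)" for j
  proof (cases "int_coeffs.ev g (z ^ j) = 0")
    case True
    then show ?thesis by auto
  next
    case False
    from root_of_unity_ring_divisors[OF z N this] show ?thesis by metis
  qed
  then obtain e where e: "\<And>j. e j > (0::nat)"
    "\<And>j p r. int_coeffs.ev g (z ^ j) \<noteq> 0 \<Longrightarrow>
      int_coeffs.ev g (z ^ j) = of_nat p * int_coeffs.ev r z \<Longrightarrow> p dvd e j"
    by metis
  \<comment> \<open>A prime dividing some \<open>e j\<close> with j < N divides \<open>E\<close>, so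
    it is at most \<open>E\<close>.\<close>
  define E where "E = (\<Prod>j<N. e j)"
  have E0: "E > 0" unfolding E_def using e(1) by (simp add: prod_pos)
  have large: "int_coeffs.ev g (z ^ k) = 0"
    if "k > 0" "\<And>q. prime q \<Longrightarrow> q dvd k \<Longrightarrow> q > E" for k
    using that
  proof (induction k rule: less_induct)
    case (less k)
    show ?case
    proof (cases "k = 1")
      case True
      with g show ?thesis by simp
    next
      case False
      then obtain p where p: "prime p" "p dvd k" using prime_factor_nat by blast
      then obtain k' where k: "k = p * k'" by (auto simp: dvd_def)
      have k': "k' > 0" "k' < k" using less.prems(1) k prime_gt_1_nat[OF p(1)] by auto
      have IH: "int_coeffs.ev g (z ^ k') = 0"
        by (rule less.IH) (use k k' less.prems in auto)
      obtain r where r: "pcompose g (monom 1 p) = g ^ p + of_nat p * r"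
        using int_poly_frobenius[OF p(1)] .
      have zk: "z ^ k = (z ^ k') ^ p"
        by (simp add: k power_mult[symmetric] mult.commute)
      have "int_coeffs.ev g (z ^ k) = int_coeffs.ev (pcompose g (monom 1 p)) (z ^ k')"
        by (simp add: zk)
      \<comment> \<open>The term \<open>g ^ p\<close> vanishes at \<open>z ^ k'\<close> by
        induction. Substituting X^k' into \<open>r\<close> expresses the cofactor as an integer
        polynomial in \<open>z\<close> itself, as the bound \<open>e\<close> requires.\<close>
      also have "\<dots> = of_nat p * int_coeffs.ev (pcompose r (monom 1 k')) z"
        unfolding r using IH prime_gt_0_nat[OF p(1)] by (simp add: zero_power)
      finally have gk: "int_coeffs.ev g (z ^ (k mod N)) = of_nat p * int_coeffs.ev (pcompose r (monom 1 k')) z"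
        unfolding root_of_unity_power_mod[OF z, of k] .
      have "\<not> p dvd e (k mod N)"
      proof
        assume "p dvd e (k mod N)"
        moreover have "e (k mod N) dvd E"
          unfolding E_def using N by (intro dvd_prodI) auto
        ultimately have "p \<le> E" using E0 by (meson dvd_imp_le dvd_trans)
        with less.prems(2)[OF p] show False by simp
      qed
      with e(2)[OF _ gk] show ?thesis
        using root_of_unity_power_mod[OF z, of k] by metis
    qed
  qed
  \<comment> \<open>The exponent m + N P is congruent to \<open>m\<close> modulo \<open>N\<close>
    and has no prime factor q \<le> E: if q divides \<open>m\<close>, it divides neither
    \<open>N\<close> nor \<open>P\<close>; otherwise it divides \<open>P\<close> but not
    \<open>m\<close>.\<close>
  define P where "P = (\<Prod>q | q \<le> E \<and> prime q \<and> \<not> q dvd m. q)"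
  have finP: "finite {q. q \<le> E \<and> prime q \<and> \<not> q dvd m}" by simp
  have P0: "P > 0" unfolding P_def by (intro prod_pos) (auto simp: prime_gt_0_nat)
  have "int_coeffs.ev g (z ^ (m + N * P)) = 0"
  proof (rule large)
    show "m + N * P > 0" using N P0 by simp
    fix q :: nat assume q: "prime q" "q dvd m + N * P"
    show "q > E"
    proof (rule ccontr)
      assume "\<not> q > E"
      then have qE: "q \<le> E" by simp
      show False
      proof (cases "q dvd m")
        case True
        then have "q dvd N * P" using q(2) by (simp add: dvd_add_right_iff)
        then have "q dvd N \<or> q dvd P" using q(1) by (simp add: prime_dvd_mult_iff)
        moreover have "\<not> q dvd N"
          using True m q(1) by (metis coprime_common_divisor not_prime_unit)
        moreover have "\<not> q dvd P"
        proof
          assume "q dvd P"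
          then obtain q' where "q' \<le> E" "prime q'" "\<not> q' dvd m" "q dvd q'"
            unfolding P_def using prime_dvd_prod_iff[OF finP q(1), of "\<lambda>q. q"] by auto
          with q(1) True show False using primes_dvd_imp_eq by blast
        qed
        ultimately show False by blast
      next
        case False
        then have "q dvd P" unfolding P_def using q(1) qE finP
          by (intro dvd_prodI) auto
        then have "q dvd N * P" by simp
        with q(2) have "q dvd m" using dvd_add_left_iff by blast
        with False show False by simp
      qed
    qed
  qed
  then show ?thesis
    by (simp add: power_add power_mult z)
qed

lemma clear_denominators:
  fixes g :: "rat poly"
  obtains c :: int and G :: "int poly"
  where "c \<noteq> 0" "\<And>z. int_coeffs.ev G z = of_int c * rat_coeffs.ev g z"
proof -
  have "\<exists>c G. c \<noteq> 0 \<and> (\<forall>z. int_coeffs.ev G z = of_int c * rat_coeffs.ev g z)"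
  proof (induction g)
    case 0
    show ?case by (intro exI[of _ 1] exI[of _ 0]) simp
  next
    case (pCons a g)
    then obtain c G where c: "c \<noteq> 0" "\<forall>z. int_coeffs.ev G z = of_int c * rat_coeffs.ev g z"
      by blast
    obtain x y where xy: "a = Rat.Fract x y" "y > 0" by (cases a) auto
    have "(of_rat a :: complex) = of_int x / of_int y"
      using xy by (simp add: of_rat_rat)
    then have "of_int (c * y) * (of_rat a :: complex) = of_int (c * x)"
      using xy by simp
    then have "int_coeffs.ev (pCons (c * x) (smult y G)) z = of_int (c * y) * rat_coeffs.ev (pCons a g) z" for z
    proof -
      have "int_coeffs.ev (pCons (c * x) (smult y G)) z
          = of_int (c * x) + z * (of_int y * (of_int c * rat_coeffs.ev g z))"
        using c(2) by simp
      also have "of_int (c * x) = of_int (c * y) * (of_rat a :: complex)"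
        using \<open>of_int (c * y) * (of_rat a :: complex) = of_int (c * x)\<close> by (rule sym)
      finally show ?thesis by (simp add: algebra_simps)
    qed
    moreover have "c * y \<noteq> 0" using c(1) xy(2) by simp
    ultimately show ?case by blast
  qed
  with that show ?thesis by blast
qed

lemma rat_poly_root_of_unity_conjugate:
  fixes z :: complex
  assumes "z ^ N = 1" "N > 0" "rat_coeffs.ev g z = 0" "coprime m N"
  shows "rat_coeffs.ev g (z ^ m) = 0"
proof -
  obtain c G where "c \<noteq> 0" and G: "\<And>z. int_coeffs.ev G z = of_int c * rat_coeffs.ev g z"
    using clear_denominators[of g] by blast
  moreover have "int_coeffs.ev G (z ^ m) = 0"
    by (rule int_poly_root_of_unity_conjugate[OF assms(1,2) _ assms(4)]) (simp add: G assms(3))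
  ultimately show ?thesis by simp
qed

section \<open>Degrees of subfields\<close>

lemma complex_subfield_0: "complex_subfield K \<Longrightarrow> 0 \<in> K"
  unfolding complex_subfield_def by (metis diff_self)

lemma complex_subfield_1: "complex_subfield K \<Longrightarrow> 1 \<in> K"
  by (simp add: complex_subfield_def)

lemma complex_subfield_diff: "complex_subfield K \<Longrightarrow> x \<in> K \<Longrightarrow> y \<in> K \<Longrightarrow> x - y \<in> K"
  by (simp add: complex_subfield_def)

lemma complex_subfield_mult: "complex_subfield K \<Longrightarrow> x \<in> K \<Longrightarrow> y \<in> K \<Longrightarrow> x * y \<in> K"
  by (simp add: complex_subfield_def)

lemma complex_subfield_inverse: "complex_subfield K \<Longrightarrow> x \<in> K \<Longrightarrow> inverse x \<in> K"
  by (simp add: complex_subfield_def)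

lemma complex_subfield_add:
  assumes "complex_subfield K" "x \<in> K" "y \<in> K"
  shows "x + y \<in> K"
proof -
  have "x - (0 - y) \<in> K"
    by (intro complex_subfield_diff complex_subfield_0 assms)
  then show ?thesis by simp
qed

lemma complex_subfield_of_rat:
  assumes K: "complex_subfield K"
  shows "of_rat q \<in> K"
proof -
  have nat: "of_nat n \<in> K" for n
    by (induction n) (simp_all add: K complex_subfield_0 complex_subfield_1 complex_subfield_add)
  have int: "of_int i \<in> K" for i
  proof (cases i rule: int_cases2)
    case (nonneg n)
    with nat show ?thesis by simp
  next
    case (nonpos n)
    have "0 - of_nat n \<in> K" by (intro complex_subfield_diff complex_subfield_0 K nat)
    with nonpos show ?thesis by simp
  qed
  obtain a b where "q = Rat.Fract a b" "b > 0" by (cases q) auto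
  then have "(of_rat q :: complex) = of_int a * inverse (of_int b)"
    by (simp add: of_rat_rat divide_inverse)
  then show ?thesis
    using complex_subfield_mult[OF K int complex_subfield_inverse[OF K int]] by metis
qed

lemma complex_subfield_subspace: "complex_subfield K \<Longrightarrow> rat_vs.subspace K"
  by (intro rat_vs.subspaceI)
    (simp_all add: complex_subfield_0 complex_subfield_add complex_subfield_mult complex_subfield_of_rat)

lemma complex_subfield_poly:
  "complex_subfield K \<Longrightarrow> z \<in> K \<Longrightarrow> rat_coeffs.ev p z \<in> K"
  by (induction p)
    (simp_all add: complex_subfield_0 complex_subfield_add complex_subfield_mult complex_subfield_of_rat)

lemma complex_subfield_rat_adjoin: "complex_subfield (rat_adjoin z)"
  unfolding rat_adjoin_def
  by (rule hull_in) (auto simp: complex_subfield_def)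

lemma mem_rat_adjoin: "z \<in> rat_adjoin z"
  unfolding rat_adjoin_def by (rule hull_inc) simp

lemma rat_adjoin_minimal: "complex_subfield K \<Longrightarrow> z \<in> K \<Longrightarrow> rat_adjoin z \<subseteq> K"
  unfolding rat_adjoin_def by (rule hull_minimal) simp_all

text \<open>Multiplication by \<open>x\<close> is rational-linear, so the span of x D is x times the
  span of \<open>D\<close>; this is one inclusion, and \<open>span_image_multE\<close> is the
  other.\<close>

lemma mult_in_span_image:
  fixes x :: complex
  assumes "y \<in> rat_vs.span D"
  shows "x * y \<in> rat_vs.span ((*) x ` D)"
  using assms
proof (induction rule: rat_vs.span_induct_alt)
  case base
  show ?case by (simp add: rat_vs.span_zero)
next
  case (step c a y)
  have "of_rat c * (x * a) + x * y \<in> rat_vs.span ((*) x ` D)"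
    by (rule rat_vs.span_add[OF rat_vs.span_scale[OF rat_vs.span_base]]) (use step in auto)
  then show ?case by (simp add: algebra_simps)
qed

lemma span_image_multE:
  fixes x :: complex
  assumes "y \<in> rat_vs.span ((*) x ` D)"
  obtains d where "d \<in> rat_vs.span D" "y = x * d"
proof -
  have "\<exists>d. d \<in> rat_vs.span D \<and> y = x * d"
    using assms
  proof (induction rule: rat_vs.span_induct_alt)
    case base
    show ?case by (intro exI[of _ 0]) (simp add: rat_vs.span_zero)
  next
    case (step c a y)
    then obtain b d where bd: "b \<in> D" "a = x * b" "d \<in> rat_vs.span D" "y = x * d" by blast
    have "of_rat c * b + d \<in> rat_vs.span D"
      by (rule rat_vs.span_add[OF rat_vs.span_scale[OF rat_vs.span_base]]) (use bd in auto)
    moreover have "of_rat c * a + y = x * (of_rat c * b + d)"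
      using bd by (simp add: algebra_simps)
    ultimately show ?case by blast
  qed
  with that show ?thesis by blast
qed

text \<open>A \<open>K\<close>-basis of \<open>L\<close> is built one vector at a time; adjoining \<open>x\<close> adds the
  \<open>dim K\<close> rational basis vectors of \<open>x K\<close>.\<close>

lemma dim_subfield_dvd:
  assumes K: "complex_subfield K" and L: "complex_subfield L" and KL: "K \<subseteq> L"
    and dimL: "rat_vs.dim L > 0"
  shows "rat_vs.dim K dvd rat_vs.dim L"
proof -
  obtain BL where BL: "BL \<subseteq> L" "rat_vs.independent BL" "L \<subseteq> rat_vs.span BL" "card BL = rat_vs.dim L"
    using rat_vs.basis_exists .
  \<comment> \<open>An infinite basis would have cardinality 0, so \<open>dim L > 0\<close> encodes
    finite dimension.\<close>
  have finBL: "finite BL" using BL(4) dimL card_gt_0_iff by metis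
  have bound: "finite S \<and> card S \<le> rat_vs.dim L" if "S \<subseteq> L" "rat_vs.independent S" for S
    using rat_vs.independent_span_bound[OF finBL that(2)] that(1) BL(3,4) by auto
  obtain B where B: "B \<subseteq> K" "rat_vs.independent B" "K \<subseteq> rat_vs.span B" "card B = rat_vs.dim K"
    using rat_vs.basis_exists .
  have finB: "finite B" using bound[of B] B KL by auto
  have subK: "rat_vs.subspace K" and subL: "rat_vs.subspace L"
    using K L by (simp_all add: complex_subfield_subspace)
  have spanB: "rat_vs.span B = K"
    using B(1,3) subK by (simp add: rat_vs.span_minimal subset_antisym)
  have "B \<noteq> {}" using B(3) complex_subfield_1[OF K] by auto
  then have cardB: "card B > 0" using finB by (simp add: card_gt_0_iff)
  show ?thesis
  proof (rule ccontr)
    assume ndvd: "\<not> ?thesis"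
    \<comment> \<open>Without divisibility no independent set of size k dim K spans
      \<open>L\<close>, so the construction never stops and outgrows dim L. Stability of the span
      under \<open>K\<close> is the invariant that makes \<open>C\<close> behave like a set spanning
      a \<open>K\<close>-space.\<close>
    have "\<exists>C. C \<subseteq> L \<and> rat_vs.independent C \<and> card C = k * card B \<and>
        (\<forall>a\<in>K. \<forall>w\<in>rat_vs.span C. a * w \<in> rat_vs.span C)" for k
    proof (induction k)
      case 0
      show ?case by (intro exI[of _ "{}"]) (simp add: rat_vs.independent_empty)
    next
      case (Suc k)
      then obtain C where C: "C \<subseteq> L" "rat_vs.independent C" "card C = k * card B"
        and stable: "\<And>a w. a \<in> K \<Longrightarrow> w \<in> rat_vs.span C \<Longrightarrow> a * w \<in> rat_vs.span C"
        by blast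
      have finC: "finite C" using bound C by blast
      have "\<not> L \<subseteq> rat_vs.span C"
      proof
        assume "L \<subseteq> rat_vs.span C"
        then have "card C = rat_vs.dim L" using C rat_vs.basis_card_eq_dim by blast
        with ndvd C(3) B(4) show False by (metis dvd_triv_right)
      qed
      then obtain x where x: "x \<in> L" "x \<notin> rat_vs.span C" by blast
      have x0: "x \<noteq> 0" using x(2) rat_vs.span_zero by blast
      \<comment> \<open>If x b = w + x d with w in the span of \<open>C\<close> and d in the span of
        \<open>D\<close>, then b - d is a nonzero element of \<open>K\<close>, and dividing by it
        would put \<open>x\<close> into the span of \<open>C\<close>.\<close>
      have ext: "rat_vs.independent (C \<union> (*) x ` D) \<and> card (C \<union> (*) x ` D) = card C + card D"
        if "D \<subseteq> B" for D
      proof -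
        have "finite D" using that finB finite_subset by blast
        then show ?thesis using that
        proof (induction D rule: finite_induct)
          case empty
          show ?case using C by simp
        next
          case (insert b D)
          have IH: "rat_vs.independent (C \<union> (*) x ` D)" "card (C \<union> (*) x ` D) = card C + card D"
            using insert by auto
          have notin: "x * b \<notin> rat_vs.span (C \<union> (*) x ` D)"
          proof
            assume "x * b \<in> rat_vs.span (C \<union> (*) x ` D)"
            then obtain w y where wy: "x * b = w + y" "w \<in> rat_vs.span C" "y \<in> rat_vs.span ((*) x ` D)"
              by (auto simp: rat_vs.span_Un)
            then obtain d where d: "d \<in> rat_vs.span D" "y = x * d" using span_image_multE by metis
            have "d \<in> K" using d(1) insert.prems spanB rat_vs.span_mono[of D B] by auto
            moreover have "b \<in> K" using insert.prems B(1) by auto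
            ultimately have inv: "inverse (b - d) \<in> K"
              by (intro complex_subfield_inverse complex_subfield_diff K)
            have "b \<notin> rat_vs.span D"
              using B(2) insert.prems insert.hyps
              by (metis rat_vs.dependent_def rat_vs.independent_mono Diff_insert_absorb insertI1)
            with d(1) have "b - d \<noteq> 0" by auto
            moreover have "x * (b - d) = w" using wy(1) d(2) by (simp add: algebra_simps)
            ultimately have "x = inverse (b - d) * w" by (simp add: field_simps)
            with stable[OF inv wy(2)] x(2) show False by simp
          qed
          have "rat_vs.independent (insert (x * b) (C \<union> (*) x ` D))"
            using notin IH(1) by (rule rat_vs.independent_insertI)
          moreover have "x * b \<notin> C \<union> (*) x ` D" using notin by (metis rat_vs.span_base)
          ultimately show ?case using IH(2) insert.hyps finC by simp
        qed
      qed
      define C' where "C' = C \<union> (*) x ` B"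
      have "C' \<subseteq> L"
        unfolding C'_def using C(1) B(1) KL x(1) L by (auto intro!: complex_subfield_mult)
      moreover have "rat_vs.independent C'" "card C' = Suc k * card B"
        unfolding C'_def using ext[of B] C(3) by simp_all
      moreover have "a * w \<in> rat_vs.span C'" if a: "a \<in> K" and w: "w \<in> rat_vs.span C'" for a w
      proof -
        obtain w1 y where wy: "w = w1 + y" "w1 \<in> rat_vs.span C" "y \<in> rat_vs.span ((*) x ` B)"
          using w unfolding C'_def by (auto simp: rat_vs.span_Un)
        then obtain d where d: "d \<in> K" "y = x * d" using span_image_multE spanB by metis
        have "x * (a * d) \<in> rat_vs.span ((*) x ` B)"
          using a d(1) spanB by (intro mult_in_span_image) (simp add: complex_subfield_mult K)
        moreover have "a * w1 \<in> rat_vs.span C" using stable a wy(2) .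
        moreover have "a * w = a * w1 + x * (a * d)" using wy(1) d(2) by (simp add: algebra_simps)
        ultimately show ?thesis unfolding C'_def rat_vs.span_Un by blast
      qed
      ultimately show ?case by blast
    qed
    from this[of "Suc (rat_vs.dim L)"] obtain C where
      "C \<subseteq> L" "rat_vs.independent C" "card C = Suc (rat_vs.dim L) * card B" by blast
    moreover from this have "card C \<le> rat_vs.dim L" using bound by blast
    ultimately show False using cardB by (metis Suc_n_not_le_n le_trans mult_le_mono2 nat_mult_1_right Suc_leI One_nat_def)
  qed
qed

lemma rat_degree_dvd:
  assumes "w \<in> rat_adjoin z" "rat_degree z > 0"
  shows "rat_degree w dvd rat_degree z"
  using dim_subfield_dvd[OF complex_subfield_rat_adjoin complex_subfield_rat_adjoin
      rat_adjoin_minimal[OF complex_subfield_rat_adjoin assms(1)]] assms(2)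
  by (simp add: rat_degree_def)

section \<open>Minimal polynomials over the rationals\<close>

lemma irreducible_dvd_iff_root:
  fixes h :: "rat poly"
  assumes h: "irreducible h" "rat_coeffs.ev h c = 0"
  shows "rat_coeffs.ev q c = 0 \<longleftrightarrow> h dvd q"
proof
  assume "h dvd q"
  with h(2) show "rat_coeffs.ev q c = 0" by (auto simp: dvd_def)
next
  assume q: "rat_coeffs.ev q c = 0"
  show "h dvd q"
  proof (rule ccontr)
    assume "\<not> h dvd q"
    then have "coprime h q"
      using h(1) by (simp add: prime_elem_imp_coprime irreducible_imp_prime_elem)
    \<comment> \<open>Evaluated at the common root \<open>c\<close>, this identity would read 0 =
      1.\<close>
    then have "fst (bezout_coefficients h q) * h + snd (bezout_coefficients h q) * q = 1"
      by (simp add: bezout_coefficients_fst_snd)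
    from arg_cong[OF this, of "\<lambda>p. rat_coeffs.ev p c"] h(2) q show False by simp
  qed
qed

lemma irreducible_poly_exists:
  assumes "g \<noteq> 0" "rat_coeffs.ev g c = 0"
  obtains h :: "rat poly" where "irreducible h" "rat_coeffs.ev h c = 0"
proof -
  define P where "P = (\<lambda>q::rat poly. q \<noteq> 0 \<and> rat_coeffs.ev q c = 0)"
  define h where "h = arg_min degree P"
  have "P g" using assms by (simp add: P_def)
  then have h: "P h" and min: "\<And>q. P q \<Longrightarrow> degree h \<le> degree q"
    unfolding h_def by (auto intro: arg_min_natI arg_min_nat_le)
  have nonunit: "\<not> is_unit q" if "P q" for q
  proof
    assume "is_unit q"
    then obtain a where "q = [:a:]" "a \<noteq> 0" by (auto simp: is_unit_poly_iff dvd_field_iff)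
    with that show False by (simp add: P_def)
  qed
  have "irreducible h"
  proof (rule irreducibleI)
    show "h \<noteq> 0" using h by (simp add: P_def)
    show "\<not> is_unit h" using nonunit h by blast
    \<comment> \<open>A factor vanishing at \<open>c\<close> already has the minimal degree, which
      leaves degree 0 for its cofactor.\<close>
    have unit: "is_unit b" if "h = a * b" "P a" for a b
    proof -
      have "b \<noteq> 0" "a \<noteq> 0" using that(1) h by (auto simp: P_def)
      with that(1) min[OF that(2)] show ?thesis
        by (simp add: degree_mult_eq is_unit_iff_degree)
    qed
    fix a b assume ab: "h = a * b"
    then have "P a \<or> P b" using h by (auto simp: P_def)
    with ab unit show "is_unit a \<or> is_unit b" by (metis mult.commute)
  qed
  with h that show ?thesis by (simp add: P_def)
qed

text \<open>The values at \<open>c\<close> of rational polynomials already form a field, inverses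
  coming from Bezout identities with \<open>h\<close>; hence they are the whole hull. Division with
  remainder by \<open>h\<close> makes the powers of \<open>c\<close> below degree h a basis.\<close>

lemma rat_degree_eq_degree:
  fixes h :: "rat poly"
  assumes h: "irreducible h" "rat_coeffs.ev h c = 0"
  shows "rat_degree c = degree h"
proof -
  define n where "n = degree h"
  define K where "K = range (\<lambda>q. rat_coeffs.ev q c)"
  have h0: "h \<noteq> 0" using h(1) by auto
  have npos: "n > 0"
  proof (rule ccontr)
    assume "\<not> n > 0"
    then have "is_unit h" using h0 by (simp add: n_def is_unit_iff_degree)
    with h(1) show False by (simp add: irreducible_not_unit)
  qed
  have small: "q = 0" if "rat_coeffs.ev q c = 0" "degree q < n" for q
  proof (rule ccontr)
    assume "q \<noteq> 0"
    moreover have "h dvd q" using that(1) irreducible_dvd_iff_root[OF h] by blast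
    ultimately have "n \<le> degree q" unfolding n_def by (rule dvd_imp_degree_le[rotated])
    with that(2) show False by simp
  qed
  have "complex_subfield K"
    unfolding complex_subfield_def
  proof (intro conjI ballI)
    show "1 \<in> K" unfolding K_def by (rule range_eqI[of _ _ 1]) simp
    fix x y assume "x \<in> K" "y \<in> K"
    then obtain p q where pq: "x = rat_coeffs.ev p c" "y = rat_coeffs.ev q c" by (auto simp: K_def)
    show "x - y \<in> K" unfolding K_def by (rule range_eqI[of _ _ "p - q"]) (simp add: pq)
    show "x * y \<in> K" unfolding K_def by (rule range_eqI[of _ _ "p * q"]) (simp add: pq)
  next
    fix x assume "x \<in> K"
    then obtain q where q: "x = rat_coeffs.ev q c" by (auto simp: K_def)
    show "inverse x \<in> K"
    proof (cases "x = 0")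
      case True
      with \<open>x \<in> K\<close> show ?thesis by simp
    next
      case False
      then have "\<not> h dvd q" using irreducible_dvd_iff_root[OF h] q by blast
      then have "coprime h q"
        using h(1) by (simp add: prime_elem_imp_coprime irreducible_imp_prime_elem)
      then have "fst (bezout_coefficients h q) * h + snd (bezout_coefficients h q) * q = 1"
        by (simp add: bezout_coefficients_fst_snd)
      from arg_cong[OF this, of "\<lambda>p. rat_coeffs.ev p c"] h(2)
      have "rat_coeffs.ev (snd (bezout_coefficients h q)) c * x = 1" by (simp add: q)
      then have "inverse x = rat_coeffs.ev (snd (bezout_coefficients h q)) c"
        using False by (simp add: field_simps)
      then show ?thesis by (simp add: K_def)
    qed
  qed
  moreover have "c \<in> K" unfolding K_def by (rule range_eqI[of _ _ "[:0, 1:]"]) simp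
  ultimately have "rat_adjoin c \<subseteq> K" by (rule rat_adjoin_minimal)
  moreover have "K \<subseteq> rat_adjoin c"
    unfolding K_def using complex_subfield_poly[OF complex_subfield_rat_adjoin mem_rat_adjoin] by auto
  ultimately have adj: "rat_adjoin c = K" by simp
  define B where "B = (\<lambda>i. c ^ i) ` {..<n}"
  \<comment> \<open>A basis is a set of vectors, so the powers must be distinct before sums over
    \<open>B\<close> can be read as sums over exponents.\<close>
  have inj: "inj_on (\<lambda>i. c ^ i) {..<n}"
  proof (rule inj_onI)
    fix i j assume ij: "i \<in> {..<n}" "j \<in> {..<n}" "c ^ i = c ^ j"
    have "monom 1 i - monom 1 j = (0 :: rat poly)"
    proof (rule small)
      show "rat_coeffs.ev (monom 1 i - monom 1 j) c = 0" using ij(3) by simp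
      show "degree (monom 1 i - monom 1 j :: rat poly) < n"
        using ij by (intro degree_diff_less) (simp_all add: degree_monom_eq)
    qed
    then have "monom (1::rat) i = monom 1 j" by simp
    then show "i = j" by (metis degree_monom_eq one_neq_zero)
  qed
  have "rat_vs.independent B"
  proof (rule rat_vs.independent_if_scalars_zero)
    show "finite B" by (simp add: B_def)
    fix f x assume sum: "(\<Sum>x\<in>B. of_rat (f x) * x) = 0" and x: "x \<in> B"
    define q where "q = (\<Sum>i<n. monom (f (c ^ i)) i)"
    have co: "coeff q i = f (c ^ i)" if "i < n" for i
      using that by (simp add: q_def coeff_sum)
    have ev_sum: "rat_coeffs.ev (\<Sum>i\<in>A. p i) c = (\<Sum>i\<in>A. rat_coeffs.ev (p i) c)" for A :: "nat set" and p
      by (induction A rule: infinite_finite_induct) simp_all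
    have "rat_coeffs.ev q c = (\<Sum>x\<in>B. of_rat (f x) * x)"
      unfolding q_def ev_sum B_def by (simp add: sum.reindex[OF inj])
    moreover have "degree q < n"
      unfolding q_def using npos
      by (intro degree_sum_less) (auto intro: le_less_trans[OF degree_monom_le])
    ultimately have "q = 0" using sum small by simp
    with x co show "f x = 0" by (auto simp: B_def)
  qed
  moreover have "B \<subseteq> rat_adjoin c"
  proof -
    have "c ^ i \<in> K" for i unfolding K_def by (rule range_eqI[of _ _ "monom 1 i"]) simp
    then show ?thesis by (auto simp: B_def adj)
  qed
  moreover have "rat_adjoin c \<subseteq> rat_vs.span B"
  proof
    fix x assume "x \<in> rat_adjoin c"
    then obtain q where q: "x = rat_coeffs.ev q c" by (auto simp: adj K_def)
    have "x = rat_coeffs.ev (h * (q div h) + q mod h) c" by (simp add: q)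
    also have "\<dots> = rat_coeffs.ev (q mod h) c"
      by (simp only: rat_coeffs.ev_add rat_coeffs.ev_mult h(2)) simp
    also have "\<dots> = (\<Sum>i\<le>degree (q mod h). of_rat (coeff (q mod h) i) * c ^ i)"
      by (simp add: poly_altdef coeff_map_poly)
    also have "\<dots> \<in> rat_vs.span B"
    proof (rule rat_vs.span_sum)
      fix i assume "i \<in> {..degree (q mod h)}"
      moreover have "degree (q mod h) < n"
        using degree_mod_less'[of h q] h0 npos unfolding n_def by (cases "q mod h = 0") auto
      ultimately show "of_rat (coeff (q mod h) i) * c ^ i \<in> rat_vs.span B"
        by (intro rat_vs.span_scale rat_vs.span_base) (auto simp: B_def)
    qed
    finally show "x \<in> rat_vs.span B" .
  qed
  ultimately have "card B = rat_vs.dim (rat_adjoin c)"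
    using rat_vs.basis_card_eq_dim by blast
  then show ?thesis
    using inj by (simp add: rat_degree_def B_def card_image n_def)
qed

section \<open>The degree of the real part of a root of unity\<close>

text \<open>On the unit circle this is the real part. The algebraic form covers every nonzero
  \<open>w\<close>, as needed for conjugates not yet known to be cosines.\<close>

definition joukowski :: "complex \<Rightarrow> complex" where
  "joukowski w = (w + inverse w) / 2"

lemma joukowski_eq_iff:
  assumes "a \<noteq> 0" "b \<noteq> 0"
  shows "joukowski a = joukowski b \<longleftrightarrow> a = b \<or> a * b = 1"
proof -
  have "a * inverse a = 1" "b * inverse b = 1" using assms by simp_all
  then have "(a - b) * (a * b - 1) = a * b * ((a + inverse a) - (b + inverse b))"
    by algebra
  also have "\<dots> = 2 * (a * b) * (joukowski a - joukowski b)"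
    by (simp add: joukowski_def diff_divide_distrib)
  finally have "joukowski a = joukowski b \<longleftrightarrow> (a - b) * (a * b - 1) = 0"
    using assms by simp
  then show ?thesis by simp
qed

lemma joukowski_surj:
  obtains w where "w \<noteq> 0" "c = joukowski w"
proof -
  \<comment> \<open>This solves w^2 - 2 c w + 1 = 0, whose other root 2 c - w is the inverse of
    \<open>w\<close>.\<close>
  define w where "w = c + csqrt (c\<^sup>2 - 1)"
  have "(w - c)\<^sup>2 = c\<^sup>2 - 1" by (simp add: w_def)
  then have eq: "w * (2 * c - w) = 1" by (simp add: power2_eq_square algebra_simps)
  then have w0: "w \<noteq> 0" by auto
  with eq have "inverse w = 2 * c - w" by (metis inverse_unique)
  with w0 that show ?thesis by (simp add: joukowski_def)
qed

fun chebyshev_T :: "nat \<Rightarrow> rat poly" where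
  "chebyshev_T 0 = 1"
| "chebyshev_T (Suc 0) = [:0, 1:]"
| "chebyshev_T (Suc (Suc n)) = [:0, 2:] * chebyshev_T (Suc n) - chebyshev_T n"

lemma chebyshev_T_joukowski:
  assumes "w \<noteq> 0"
  shows "rat_coeffs.ev (chebyshev_T n) (joukowski w) = joukowski (w ^ n)"
proof (induction n rule: chebyshev_T.induct)
  case (3 n)
  have "rat_coeffs.ev (chebyshev_T (Suc (Suc n))) (joukowski w)
      = 2 * joukowski w * joukowski (w ^ Suc n) - joukowski (w ^ n)"
    unfolding chebyshev_T.simps rat_coeffs.ev_diff rat_coeffs.ev_mult 3 by simp
  also have "\<dots> = joukowski (w ^ Suc (Suc n))"
  proof -
    have alg: "a * b = 1 \<Longrightarrow> (a + b) * (a * c + b * d) - (c + d) = a * (a * c) + b * (b * d)"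
      for a b c d :: complex by algebra
    have "(w + inverse w) * (w * w ^ n + inverse w * inverse (w ^ n)) - (w ^ n + inverse (w ^ n))
        = w * (w * w ^ n) + inverse w * (inverse w * inverse (w ^ n))"
      by (rule alg) (use assms in simp)
    moreover have "A * B - C = R \<Longrightarrow> 2 * (A / 2) * (B / 2) - C / 2 = R / 2" for A B C R :: complex
      by (auto simp: diff_divide_distrib)
    ultimately show ?thesis
      unfolding joukowski_def power_Suc inverse_mult_distrib by blast
  qed
  finally show ?case .
qed (simp_all add: joukowski_def)

text \<open>A rational polynomial in (w + 1/w)/2 thus detects whether w^n = 1, so the order of
  \<open>w\<close> can be compared across conjugates.\<close>

lemma chebyshev_T_eq_1_iff:
  assumes "w \<noteq> 0"
  shows "rat_coeffs.ev (chebyshev_T n - 1) (joukowski w) = 0 \<longleftrightarrow> w ^ n = 1"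
proof -
  have "joukowski 1 = 1" by (simp add: joukowski_def)
  moreover have "joukowski (w ^ n) = joukowski 1 \<longleftrightarrow> w ^ n = 1"
    using assms joukowski_eq_iff[of "w ^ n" 1] by auto
  ultimately show ?thesis
    using chebyshev_T_joukowski[OF assms, of n] \<open>joukowski 1 = 1\<close> by simp
qed

text \<open>The witness is the value at \<open>joukowski 2\<close>, because 2 is not a root of
  unity.\<close>

lemma chebyshev_T_neq_1:
  assumes "n > 0"
  shows "chebyshev_T n - 1 \<noteq> 0"
proof
  assume "chebyshev_T n - 1 = 0"
  then have "(2::complex) ^ n = 1"
    using chebyshev_T_eq_1_iff[of 2 n] by (metis map_poly_0 poly_0 zero_neq_numeral)
  then have "norm ((2::complex) ^ n) = 1" by simp
  then have "(2::real) ^ n = 1" by (simp add: norm_power)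
  with assms one_less_power[of "2::real" n] show False by simp
qed

text \<open>Separability in characteristic zero: a multiple root would make \<open>h\<close> divide
  its nonzero derivative, which has smaller degree.\<close>

lemma irreducible_degree_eq_card_roots:
  assumes "irreducible h"
  shows "degree h = card {z. rat_coeffs.ev h z = 0}"
proof -
  let ?P = "map_poly of_rat h :: complex poly"
  have pd: "pderiv ?P = map_poly of_rat (pderiv h)"
    by (rule poly_eqI) (simp add: coeff_pderiv coeff_map_poly of_rat_mult of_rat_add)
  have h0: "h \<noteq> 0" using assms by auto
  then have deg: "degree h > 0"
    using assms is_unit_iff_degree irreducible_not_unit by (metis gr0I)
  have "rsquarefree ?P"
    unfolding rsquarefree_roots
  proof (intro allI notI)
    fix a assume a: "poly ?P a = 0 \<and> poly (pderiv ?P) a = 0"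
    then have "h dvd pderiv h"
      using irreducible_dvd_iff_root[OF assms] pd by metis
    moreover have "pderiv h \<noteq> 0" using deg by (simp add: pderiv_eq_0_iff)
    ultimately have "degree h \<le> degree (pderiv h)" by (rule dvd_imp_degree_le)
    with deg show False by (simp add: degree_pderiv)
  qed
  from complex_poly_decompose_rsquarefree[OF this]
  have "degree ?P = degree (smult (lead_coeff ?P) (\<Prod>z | poly ?P z = 0. [:-z, 1:]))" by simp
  also have "\<dots> = card {z. poly ?P z = 0}"
    using h0 by (simp add: degree_prod_eq_sum_degree coeff_map_poly)
  finally show ?thesis by simp
qed

section \<open>Totatives and powers of a primitive root of unity\<close>

lemma totatives_reflect:
  assumes "N > 2" "j \<in> totatives N"
  shows "N - j \<in> totatives N"
proof -
  have "j < N" "coprime j N" using assms totatives_less[of j N] by (auto simp: in_totatives_iff)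
  then show ?thesis
    by (auto simp: in_totatives_iff coprime_iff_gcd_eq_1 gcd_diff2_nat)
qed

lemma double_totative_neq:
  assumes "N > 2" "j \<in> totatives N"
  shows "2 * j \<noteq> N"
proof
  assume "2 * j = N"
  moreover from this have "j dvd N" by (metis dvd_triv_right)
  ultimately show False
    using assms by (auto simp: in_totatives_iff)
qed

text \<open>The reflection j -> N - j pairs the totatives without fixed points. Since
  \<open>z ^ j\<close> and \<open>z ^ (N - j)\<close> have the same image under
  \<open>joukowski\<close>, the lower half indexes the distinct conjugates.\<close>

lemma totient_eq_double_card:
  assumes "N > 2"
  shows "totient N = 2 * card {j \<in> totatives N. 2 * j < N}"
proof -
  define H where "H = {j \<in> totatives N. 2 * j < N}"
  note refl = totatives_reflect[OF assms] and half = double_totative_neq[OF assms]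
  have "totatives N = H \<union> (\<lambda>j. N - j) ` H"
  proof (intro equalityI subsetI)
    fix j assume j: "j \<in> totatives N"
    show "j \<in> H \<union> (\<lambda>j. N - j) ` H"
    proof (cases "2 * j < N")
      case True
      with j show ?thesis by (simp add: H_def)
    next
      case False
      then have "2 * (N - j) < N" using half[OF j] assms by linarith
      then have "N - j \<in> H" using refl[OF j] by (simp add: H_def)
      moreover have "j = N - (N - j)" using totatives_le[OF j] by simp
      ultimately show ?thesis by blast
    qed
  next
    fix j assume "j \<in> H \<union> (\<lambda>j. N - j) ` H"
    then show "j \<in> totatives N" using refl by (auto simp: H_def)
  qed
  moreover have "H \<inter> (\<lambda>j. N - j) ` H = {}" by (auto simp: H_def)
  moreover have "inj_on (\<lambda>j. N - j) H" by (auto simp: H_def inj_on_def)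
  moreover have "finite H" by (simp add: H_def)
  ultimately have "card (totatives N) = 2 * card H"
    by (simp add: card_Un_disjoint card_image)
  then show ?thesis by (simp add: totient_def H_def)
qed

lemma primitive_root_power_inj:
  fixes z :: complex
  assumes prim: "\<And>j. z ^ j = 1 \<longleftrightarrow> N dvd j" and ij: "i < N" "j < N" "z ^ i = z ^ j"
  shows "i = j"
proof -
  have *: "i = j" if "i \<le> j" "j < N" "z ^ i = z ^ j" for i j
  proof -
    have "z ^ N = 1" using prim by simp
    then have "z \<noteq> 0" using that(2) by (auto simp: power_0_left)
    moreover have "z ^ j = z ^ i * z ^ (j - i)" using that(1) by (simp flip: power_add)
    ultimately have "z ^ (j - i) = 1" using that(3) by simp
    then have "N dvd j - i" using prim by simp
    with that(1,2) show ?thesis using nat_dvd_not_less[of "j - i" N] by linarith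
  qed
  show ?thesis using *[of i j] *[of j i] ij by (cases "i \<le> j") auto
qed

text \<open>The N distinct powers of \<open>z\<close> exhaust the N solutions of w^N = 1 by
  counting.\<close>

lemma primitive_root_powers:
  fixes z :: complex
  assumes prim: "\<And>j. z ^ j = 1 \<longleftrightarrow> N dvd j" and N: "N > 0" and w: "w ^ N = 1"
  obtains j where "j < N" "w = z ^ j"
proof -
  have zN: "z ^ N = 1" using prim by simp
  have "(\<lambda>j. z ^ j) ` {..<N} = {w. w ^ N = 1}"
  proof (rule card_subset_eq)
    show "finite {w::complex. w ^ N = 1}" using N by (simp add: finite_roots_unity)
    show "(\<lambda>j. z ^ j) ` {..<N} \<subseteq> {w. w ^ N = 1}"
      using zN by auto (metis mult.commute power_mult power_one)
    have "inj_on (\<lambda>j. z ^ j) {..<N}"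
      by (rule inj_onI) (use primitive_root_power_inj[OF prim] in auto)
    then show "card ((\<lambda>j. z ^ j) ` {..<N}) = card {w::complex. w ^ N = 1}"
      using N by (simp add: card_image card_roots_unity_eq)
  qed
  with w that show ?thesis by blast
qed

text \<open>The conjugates of \<open>(z + 1/z)/2\<close> are the \<open>(z^j + z^(-j))/2\<close> with \<open>j\<close> coprime to \<open>N\<close>:
  a further root would come from a root of unity of smaller order \<open>M\<close>, so the minimal polynomial
  would divide \<open>T\<^sub>M - 1\<close>.\<close>

lemma rat_degree_real_part_root_of_unity:
  assumes prim: "\<And>j. z ^ j = 1 \<longleftrightarrow> N dvd j" and N: "N > 2"
  shows "2 * rat_degree (joukowski z) = totient N"
proof -
  let ?H = "{j \<in> totatives N. 2 * j < N}"
  have N0: "N > 0" using N by simp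
  have zN: "z ^ N = 1" using prim by simp
  then have z0: "z \<noteq> 0" using N by (auto simp: power_0_left)
  have "rat_coeffs.ev (chebyshev_T N - 1) (joukowski z) = 0"
    using chebyshev_T_eq_1_iff[OF z0] zN by blast
  with chebyshev_T_neq_1[OF N0] obtain h
    where h: "irreducible h" "rat_coeffs.ev h (joukowski z) = 0"
    by (rule irreducible_poly_exists)
  have "{x. rat_coeffs.ev h x = 0} = (\<lambda>j. joukowski (z ^ j)) ` ?H"
  proof (intro equalityI subsetI)
    fix x assume "x \<in> (\<lambda>j. joukowski (z ^ j)) ` ?H"
    then obtain j where j: "x = joukowski (z ^ j)" "coprime j N" by (auto simp: in_totatives_iff)
    \<comment> \<open>For N-th roots of unity y the inverse is y^(N-1), so \<open>G\<close>
      expresses h((y + 1/y)/2) as a polynomial in y, to which conjugation applies.\<close>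
    define G where "G = pcompose h (smult (1/2) (monom 1 1 + monom 1 (N - 1)))"
    have G: "rat_coeffs.ev G y = rat_coeffs.ev h (joukowski y)" if "y ^ N = 1" for y
    proof -
      have "y * y ^ (N - 1) = 1" using that N by (metis power_minus_mult mult.commute N0)
      then have "inverse y = y ^ (N - 1)" by (rule inverse_unique)
      then show ?thesis by (simp add: G_def of_rat_divide joukowski_def)
    qed
    have "rat_coeffs.ev G (z ^ j) = 0"
      by (rule rat_poly_root_of_unity_conjugate[OF zN N0 _ j(2)]) (use G zN h(2) in simp)
    moreover have "(z ^ j) ^ N = 1" using zN by (metis mult.commute power_mult power_one)
    ultimately show "x \<in> {x. rat_coeffs.ev h x = 0}" using G j(1) by simp
  next
    fix x assume "x \<in> {x. rat_coeffs.ev h x = 0}"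
    then have hx: "rat_coeffs.ev h x = 0" by simp
    obtain w where w: "w \<noteq> 0" "x = joukowski w" by (rule joukowski_surj)
    \<comment> \<open>Up to a scalar, \<open>h\<close> is the minimal polynomial of both
      \<open>joukowski z\<close> and \<open>x\<close>, so T_M - 1 vanishes at both or at
      neither.\<close>
    have order: "z ^ M = 1 \<longleftrightarrow> w ^ M = 1" for M
      using chebyshev_T_eq_1_iff[OF z0] chebyshev_T_eq_1_iff[OF w(1)]
        irreducible_dvd_iff_root[OF h] irreducible_dvd_iff_root[OF h(1) hx] w(2) by metis
    then obtain j where j: "j < N" "w = z ^ j"
      using primitive_root_powers[OF prim N0, of w] zN by metis
    \<comment> \<open>A common factor of \<open>j\<close> and \<open>N\<close> would give
      \<open>w\<close> a smaller order than \<open>z\<close>.\<close>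
    have "z ^ (N div gcd j N) = 1"
    proof -
      have "j * (N div gcd j N) = N * (j div gcd j N)"
        by (metis div_mult_swap dvd_div_mult gcd_dvd1 gcd_dvd2 mult.commute)
      then have "w ^ (N div gcd j N) = 1" using zN by (metis j(2) power_mult power_one)
      with order show ?thesis by blast
    qed
    then have "N dvd N div gcd j N" using prim by blast
    then have "gcd j N = 1"
      using N0 by (metis div_by_1 div_less_dividend dvd_imp_le gcd_pos_nat linorder_neqE_nat
          nat_dvd_not_less less_one neq0_conv div_greater_zero_iff gcd_le2_nat)
    then have cop: "coprime j N" by (simp add: coprime_iff_gcd_eq_1)
    then have "j \<noteq> 0" using N by (intro notI) simp
    then have jt: "j \<in> totatives N" using cop j(1) by (simp add: in_totatives_iff)
    have inv: "z ^ (N - j) = inverse (z ^ j)"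
      using j(1) zN by (intro inverse_unique[symmetric]) (simp flip: power_add)
    show "x \<in> (\<lambda>j. joukowski (z ^ j)) ` ?H"
    proof (cases "2 * j < N")
      case True
      with jt w(2) j(2) show ?thesis by blast
    next
      case False
      with double_totative_neq[OF N jt] N have "2 * (N - j) < N" by linarith
      moreover note totatives_reflect[OF N jt]
      moreover have "joukowski (z ^ (N - j)) = x"
        unfolding inv using w(2) j(2) by (simp add: joukowski_def add.commute)
      ultimately show ?thesis by (intro image_eqI[of _ _ "N - j"]) auto
    qed
  qed
  moreover have "inj_on (\<lambda>j. joukowski (z ^ j)) ?H"
  proof (rule inj_onI)
    fix i j assume ij: "i \<in> ?H" "j \<in> ?H" "joukowski (z ^ i) = joukowski (z ^ j)"
    then have "z ^ i = z ^ j \<or> z ^ (i + j) = 1"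
      using joukowski_eq_iff[of "z ^ i" "z ^ j"] z0 by (simp add: power_add)
    \<comment> \<open>In the lower half 0 < i + j < N, which rules out that the two powers are
      mutually inverse.\<close>
    moreover have "\<not> N dvd i + j"
      using ij by (intro nat_dvd_not_less) (auto simp: in_totatives_iff)
    ultimately have "z ^ i = z ^ j" using prim by blast
    then show "i = j" using ij by (intro primitive_root_power_inj[OF prim]) auto
  qed
  ultimately have "degree h = card ?H"
    by (simp add: irreducible_degree_eq_card_roots[OF h(1)] card_image)
  then show ?thesis
    using rat_degree_eq_degree[OF h] totient_eq_double_card[OF N] by simp
qed

section \<open>The new part of the Pell sequence\<close>

text \<open>The element u + v sqrt(D) has trace 2 u and norm 1, so it satisfies X^2 = 2 u X - 1; the
  recurrence is the sqrt(D)-coordinate of this equation times the n-th power.\<close>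

lemma pell_v_recurrence:
  assumes "pell_solution D u v"
  shows "pell_v D u v (Suc (Suc n)) = 2 * u * pell_v D u v (Suc n) - pell_v D u v n"
proof -
  obtain a b where ab: "pell_pow D u v n = (a, b)" by fastforce
  have uu: "u * u = 1 + D * (v * v)"
    using assms by (simp add: pell_solution_def power2_eq_square algebra_simps)
  have "u * (u * b + v * a) + v * (u * a + D * v * b)
      = 2 * u * (u * b + v * a) - u * u * b + D * (v * v) * b"
    by (simp add: algebra_simps)
  also have "\<dots> = 2 * u * (u * b + v * a) - b"
    unfolding uu by (simp add: algebra_simps)
  finally show ?thesis by (simp add: pell_v_def ab)
qed

text \<open>The index is shifted: \<open>chebyshev_U n\<close> is the classical \<open>U\<^sub>n\<^sub>-\<^sub>1\<close>, of degree \<open>n - 1\<close>.\<close>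

fun chebyshev_U :: "nat \<Rightarrow> complex poly" where
  "chebyshev_U 0 = 0"
| "chebyshev_U (Suc 0) = 1"
| "chebyshev_U (Suc (Suc n)) = [:0, 2:] * chebyshev_U (Suc n) - chebyshev_U n"

lemma pell_v_eq_chebyshev_U:
  assumes "pell_solution D u v"
  shows "pell_v D u v n = v * pcompose (chebyshev_U n) u"
proof (induction n rule: chebyshev_U.induct)
  case (3 n)
  have "pcompose [:0, 2:] u = 2 * u"
    by (simp only: pcompose_pCons pcompose_0 numeral_poly) simp
  then show ?case
    unfolding pell_v_recurrence[OF assms] 3 chebyshev_U.simps pcompose_diff pcompose_mult
    by (simp add: algebra_simps)
qed (simp_all add: pell_v_def pcompose_1)

lemma chebyshev_U_sin: "poly (chebyshev_U n) (cos (of_real t)) * sin (of_real t) = sin (of_nat n * of_real t)"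
proof (induction n rule: chebyshev_U.induct)
  case (3 n)
  let ?x = "of_real t :: complex"
  have "poly (chebyshev_U (Suc (Suc n))) (cos ?x) * sin ?x
      = 2 * cos ?x * (poly (chebyshev_U (Suc n)) (cos ?x) * sin ?x) - poly (chebyshev_U n) (cos ?x) * sin ?x"
    by (simp add: algebra_simps)
  also have "\<dots> = 2 * cos ?x * sin (of_nat (Suc n) * ?x) - sin (of_nat n * ?x)"
    unfolding 3 ..
  also have "\<dots> = sin (of_nat (Suc n) * ?x + ?x)"
  proof -
    have "of_nat n * ?x = of_nat (Suc n) * ?x - ?x" by (simp add: algebra_simps)
    then show ?thesis by (simp only: sin_add sin_diff) simp
  qed
  also have "of_nat (Suc n) * ?x + ?x = of_nat (Suc (Suc n)) * ?x" by (simp add: algebra_simps)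
  finally show ?case .
qed simp_all

text \<open>Both claims go through one induction: the coefficient claim needs the degree bound on
  the subtracted polynomial.\<close>

lemma chebyshev_U_degree: "degree (chebyshev_U n) \<le> n - 1 \<and> coeff (chebyshev_U (Suc n)) n = 2 ^ n"
proof (induction n rule: chebyshev_U.induct)
  case (3 n)
  have "degree (chebyshev_U (Suc (Suc n))) \<le> Suc n"
    unfolding chebyshev_U.simps using 3
    by (intro degree_diff_le order.trans[OF degree_mult_le]) (auto intro: order.trans)
  moreover have "coeff (chebyshev_U (Suc n)) (Suc (Suc n)) = 0"
    using 3 by (intro coeff_eq_0) simp
  ultimately show ?case using 3 by simp
qed (simp_all)

text \<open>Both sides have degree at most n - 1, the same coefficient 2^(n-1) there, and vanish at
  n - 1 points, distinct because cosine is injective on [0, pi].\<close>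

lemma chebyshev_U_factorization:
  assumes "n > 0"
  shows "chebyshev_U n = (\<Prod>k\<in>{0<..<n}. [:- 2 * cos (of_real (real k / real n * pi)), 2:])"
proof -
  obtain m where m: "n = Suc m" using assms by (cases n) auto
  let ?t = "\<lambda>k. real k / real n * pi"
  let ?P = "\<Prod>k\<in>{0<..<n}. [:- 2 * cos (of_real (?t k)), 2 :: complex:]"
  let ?A = "(\<lambda>k. cos (of_real (?t k)) :: complex) ` {0<..<n}"
  have range: "0 < ?t k \<and> ?t k < pi" if "k \<in> {0<..<n}" for k
    using that by (auto simp: divide_simps)
  have inj: "inj_on (\<lambda>k. cos (of_real (?t k)) :: complex) {0<..<n}"
  proof (rule inj_onI)
    fix i j assume ij: "i \<in> {0<..<n}" "j \<in> {0<..<n}"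
      and eq: "cos (of_real (?t i)) = (cos (of_real (?t j)) :: complex)"
    from eq have "cos (?t i) = cos (?t j)" by (simp only: cos_of_real of_real_eq_iff)
    then have "?t i = ?t j"
      using cos_inj_pi[of "?t i" "?t j"] range[OF ij(1)] range[OF ij(2)] by (meson less_imp_le)
    then show "i = j" using assms by simp
  qed
  have deg: "degree ?P = m"
    by (subst degree_prod_eq_sum_degree) (simp_all add: m)
  show ?thesis
  proof (rule poly_eqI_degree_lead_coeff[where n = m and A = ?A])
    have "coeff ?P m = lead_coeff ?P" using deg by simp
    also have "\<dots> = 2 ^ m" by (simp add: lead_coeff_prod m)
    finally show "coeff (chebyshev_U n) m = coeff ?P m"
      using chebyshev_U_degree[of m] m by simp
    show "m \<le> card ?A" using inj by (simp add: card_image m)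
    show "degree (chebyshev_U n) \<le> m" using chebyshev_U_degree[of n] m by simp
    show "degree ?P \<le> m" using deg by simp
    fix z assume "z \<in> ?A"
    then obtain k where k: "k \<in> {0<..<n}" "z = cos (of_real (?t k))" by auto
    have "sin (of_nat n * of_real (?t k) :: complex) = of_real (sin (real k * pi))"
      using assms by (simp add: sin_of_real[symmetric] del: sin_of_real)
    moreover have "sin (of_real (?t k) :: complex) \<noteq> 0"
      using sin_gt_zero[of "?t k"] range[OF k(1)] unfolding sin_of_real of_real_eq_0_iff by simp
    ultimately have "poly (chebyshev_U n) z = 0"
      using chebyshev_U_sin[of n "?t k"] k(2) by simp
    moreover have "poly ?P z = 0"
      using k by (auto simp: poly_prod intro!: prod_zero bexI[of _ k])
    ultimately show "poly (chebyshev_U n) z = poly ?P z" by simp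
  qed
qed

text \<open>The fractions i/k are grouped by their denominators in lowest terms; denominator 1 would
  need i = k. The result is a product over divisors, the shape that defines the new part.\<close>

lemma prod_reduced_fractions:
  fixes f :: "real \<Rightarrow> 'a::comm_monoid_mult"
  assumes k: "k > 0"
  shows "(\<Prod>m\<in>{m. m dvd k} - {1}. \<Prod>j\<in>totatives m. f (real j / real m))
      = (\<Prod>i\<in>{0<..<k}. f (real i / real k))"
proof -
  let ?g = "\<lambda>i. k div gcd i k"
  have "(\<Prod>j\<in>totatives m. f (real j / real m)) = (\<Prod>i\<in>{i\<in>{0<..<k}. ?g i = m}. f (real i / real k))"
    if m: "m \<in> {m. m dvd k} - {1}" for m
  proof -
    obtain d where d: "k = m * d" using m by auto
    have md: "m > 0" "d > 0" "k div d = m" using d k by auto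
    \<comment> \<open>Widening the range to i = k is harmless: there the gcd is m d, which differs
      from \<open>d\<close> because m is not 1.\<close>
    have set: "{i\<in>{0<..<k}. ?g i = m} = {i\<in>{0<..k}. gcd i k = d}"
    proof (intro equalityI subsetI)
      fix i assume i: "i \<in> {i\<in>{0<..<k}. ?g i = m}"
      then have "m * gcd i k = m * d" using d by (metis (mono_tags) dvd_div_mult_self gcd_dvd2 mem_Collect_eq)
      with md i show "i \<in> {i\<in>{0<..k}. gcd i k = d}" by auto
    next
      fix i assume i: "i \<in> {i\<in>{0<..k}. gcd i k = d}"
      moreover have "i \<noteq> k"
      proof
        assume "i = k"
        with i have "m * d = d" using d by auto
        with md m show False by simp
      qed
      ultimately show "i \<in> {i\<in>{0<..<k}. ?g i = m}" using md by auto
    qed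
    have bij: "bij_betw (\<lambda>j. j * d) (totatives m) {i\<in>{0<..k}. gcd i k = d}"
      using bij_betw_totatives_gcd_eq[of d k] d k md by simp
    have "(\<Prod>i\<in>{i\<in>{0<..<k}. ?g i = m}. f (real i / real k))
        = (\<Prod>j\<in>totatives m. f (real (j * d) / real k))"
      unfolding set by (rule prod.reindex_bij_betw[OF bij, symmetric])
    also have "\<dots> = (\<Prod>j\<in>totatives m. f (real j / real m))"
      using d md by (intro prod.cong refl) simp
    finally show ?thesis ..
  qed
  then have "(\<Prod>m\<in>{m. m dvd k} - {1}. \<Prod>j\<in>totatives m. f (real j / real m))
      = (\<Prod>m\<in>{m. m dvd k} - {1}. \<Prod>i\<in>{i\<in>{0<..<k}. ?g i = m}. f (real i / real k))"
    by (rule prod.cong[OF refl])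
  also have "\<dots> = (\<Prod>i\<in>{0<..<k}. f (real i / real k))"
  proof (rule prod.group)
    show "finite ({m. m dvd k} - {1})" using k by simp
    show "?g ` {0<..<k} \<subseteq> {m. m dvd k} - {1}"
    proof (intro image_subsetI DiffI)
      fix i assume i: "i \<in> {0<..<k}"
      show "?g i \<in> {m. m dvd k}" by simp (metis dvd_div_mult_self dvd_triv_left gcd_dvd2)
      show "?g i \<notin> {1}"
      proof
        assume "?g i \<in> {1}"
        then have "gcd i k = k" by (metis dvd_div_mult_self gcd_dvd2 mult_1 singletonD)
        then have "k dvd i" by (metis gcd_dvd1)
        with i show False by (auto dest: dvd_imp_le)
      qed
    qed
  qed simp
  finally show ?thesis .
qed

text \<open>The linear factor 2 X - 2 cos(x pi) of a \<open>chebyshev_U\<close>, with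
  \<open>u\<close> substituted for X. It depends on the fraction \<open>x\<close> alone, which
  permits regrouping by reduced fractions.\<close>

definition cos_factor :: "complex poly \<Rightarrow> real \<Rightarrow> complex poly" where
  "cos_factor u x = [:- 2 * cos (of_real (x * pi)):] + smult 2 u"

text \<open>This supplies a sequence satisfying the defining product. The index 1 is separate
  because \<open>totatives 1\<close> is {1}, which would contribute 2 u + 2 in place of
  \<open>v\<close>.\<close>

lemma pell_v_factorization:
  assumes "pell_solution D u v" "k > 0"
  shows "pell_v D u v k
      = (\<Prod>m | m dvd k. if m = 1 then v else \<Prod>j\<in>totatives m. cos_factor u (real j / real m))"
proof -
  have "pell_v D u v k = v * (\<Prod>i\<in>{0<..<k}. cos_factor u (real i / real k))"
    unfolding pell_v_eq_chebyshev_U[OF assms(1)] chebyshev_U_factorization[OF assms(2)]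
    by (simp add: pcompose_prod pcompose_pCons cos_factor_def)
  also have "\<dots> = v * (\<Prod>m\<in>{m. m dvd k} - {1}. \<Prod>j\<in>totatives m. cos_factor u (real j / real m))"
    by (simp only: prod_reduced_fractions[OF assms(2)])
  also have "\<dots> = (\<Prod>m | m dvd k. if m = 1 then v else \<Prod>j\<in>totatives m. cos_factor u (real j / real m))"
  proof -
    have "finite {m. m dvd k}" "1 \<in> {m. m dvd k}" using assms(2) by simp_all
    then show ?thesis by (subst prod.remove[of _ 1]) (auto intro!: arg_cong[of _ _ "\<lambda>x. v * x"] prod.cong)
  qed
  finally show ?thesis .
qed

text \<open>Uniqueness by strong induction along divisors: the product over the proper divisors
  agrees for both sequences and is nonzero, so it cancels.\<close>

lemma pell_v_new_eqI:
  fixes D u v :: "'a::idom poly"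
  assumes w: "\<And>k. k \<ge> 1 \<Longrightarrow> pell_v D u v k = (\<Prod>m | m dvd k. w m)"
    and nz: "\<And>k. k \<ge> 1 \<Longrightarrow> pell_v D u v k \<noteq> 0" and n: "n \<ge> 1"
  shows "pell_v_new D u v n = w n"
  unfolding pell_v_new_def
proof (rule the_equality)
  show "\<exists>w'. (\<forall>k\<ge>1. pell_v D u v k = (\<Prod>m | m dvd k. w' m)) \<and> w' n = w n"
    using w by blast
next
  fix p assume "\<exists>w'. (\<forall>k\<ge>1. pell_v D u v k = (\<Prod>m | m dvd k. w' m)) \<and> w' n = p"
  then obtain w' where w': "\<And>k. k \<ge> 1 \<Longrightarrow> pell_v D u v k = (\<Prod>m | m dvd k. w' m)" "w' n = p"
    by blast
  have "w' k = w k" if "k \<ge> 1" for k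
    using that
  proof (induction k rule: less_induct)
    case (less k)
    have fin: "finite {m. m dvd k}" using less.prems by simp
    have split: "(\<Prod>m | m dvd k. f m) = f k * (\<Prod>m\<in>{m. m dvd k} - {k}. f m)" for f :: "nat \<Rightarrow> 'a poly"
      using fin by (rule prod.remove) simp
    have "w' m = w m" if "m \<in> {m. m dvd k} - {k}" for m
      using that less.prems by (intro less.IH) (auto dest: dvd_imp_le intro: le_neq_implies_less Suc_leI dvd_pos_nat)
    then have "(\<Prod>m\<in>{m. m dvd k} - {k}. w' m) = (\<Prod>m\<in>{m. m dvd k} - {k}. w m)"
      by (rule prod.cong[OF refl])
    moreover have "w' k * (\<Prod>m\<in>{m. m dvd k} - {k}. w' m) = w k * (\<Prod>m\<in>{m. m dvd k} - {k}. w m)"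
      using w(1)[OF less.prems] w'(1)[OF less.prems] unfolding split by simp
    moreover have "(\<Prod>m\<in>{m. m dvd k} - {k}. w m) \<noteq> 0"
      using nz[OF less.prems] w[OF less.prems] unfolding split by auto
    ultimately show ?case by simp
  qed
  with n w'(2) show "p = w n" by blast
qed

lemma pell_v_new_eq_prod:
  assumes sol: "pell_solution D u v" and "v \<noteq> 0" and "degree D > 0" and n: "n > 1"
  shows "pell_v_new D u v n = (\<Prod>j\<in>totatives n. cos_factor u (real j / real n))"
proof -
  \<comment> \<open>A nonconstant \<open>u\<close> keeps every \<open>cos_factor\<close> from being
    the zero polynomial.\<close>
  have "degree u > 0" using pell_solution_degree[OF assms(1-3)] assms(3) by linarith
  then have nz: "cos_factor u x \<noteq> 0" for x
  proof -
    have "degree (cos_factor u x) = degree (smult 2 u)"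
      unfolding cos_factor_def by (rule degree_add_eq_right) (use \<open>degree u > 0\<close> in simp)
    with \<open>degree u > 0\<close> show ?thesis by auto
  qed
  let ?w = "\<lambda>m. if m = 1 then v else \<Prod>j\<in>totatives m. cos_factor u (real j / real m)"
  have "pell_v_new D u v n = ?w n"
  proof (rule pell_v_new_eqI)
    fix k :: nat assume k: "k \<ge> 1"
    then show eq: "pell_v D u v k = (\<Prod>m | m dvd k. ?w m)"
      using pell_v_factorization[OF sol, of k] by simp
    have "(\<Prod>m | m dvd k. ?w m) \<noteq> 0"
      using k nz \<open>v \<noteq> 0\<close> by simp
    then show "pell_v D u v k \<noteq> 0" unfolding eq .
  qed (use n in simp)
  with n show ?thesis by simp
qed

section \<open>Odd prime degrees\<close>

text \<open>As \<open>e\<close> is odd, \<open>totient n\<close> contains exactly one factor 2.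
  Every odd prime dividing \<open>n\<close> contributes such a factor, so \<open>n\<close> is a
  prime power.\<close>

lemma totient_eq_double_prime:
  assumes n: "odd n" "n > 3" and tot: "totient n = 2 * e" and e: "e dvd d"
    and d: "prime d" "odd d"
  shows "(n = 2 * d + 1 \<and> prime n) \<or> (n = 9 \<and> d = 3)"
proof -
  have "e = 1 \<or> e = d" using d(1) e by (simp add: prime_nat_iff)
  then have odd_e: "odd e" using d(2) by auto
  obtain p where p: "prime p" "p dvd n" using n(2) prime_factor_nat[of n] by auto
  obtain m where m: "n = p ^ multiplicity p n * m" "\<not> p dvd m"
    using multiplicity_decompose'[of n p] n(2) p(1) prime_gt_1_nat by (metis less_nat_zero_code nat_dvd_1_iff_1 less_irrefl)
  obtain a where a: "multiplicity p n = Suc a"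
    using p(2) m by (cases "multiplicity p n") auto
  have "odd p" using p(2) n(1) by (meson dvd_trans)
  then have p3: "p \<ge> 3" using prime_ge_2_nat[OF p(1)] by (cases "p = 2") auto
  have even_p: "even (p - 1)" using \<open>odd p\<close> by simp
  have "coprime (p ^ Suc a) m" using p(1) m(2) by (simp add: prime_imp_coprime coprime_power_left_iff)
  then have tot_n: "totient n = p ^ a * (p - 1) * totient m"
    using m(1) a by (metis totient_mult_coprime totient_prime_power_Suc p(1))
  have "m = 1"
  proof (rule ccontr)
    assume "m \<noteq> 1"
    moreover have "odd m" using n(1) m(1) by (metis dvd_mult)
    ultimately have "m > 2" by (cases m) (auto elim: oddE)
    then have "even (totient m)" by (rule totient_even)
    with even_p have "2 * 2 dvd p ^ a * ((p - 1) * totient m)"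
      by (intro dvd_mult mult_dvd_mono)
    then have "2 * 2 dvd 2 * e" using tot tot_n by (simp add: mult.assoc)
    with odd_e show False by simp
  qed
  then have n_eq: "n = p ^ Suc a" and te: "p ^ a * (p - 1) = 2 * e"
    using m(1) a tot tot_n by simp_all
  show ?thesis
  proof (cases a)
    case 0
    then have "n = p" "p - 1 = 2 * e" using n_eq te by simp_all
    \<comment> \<open>The alternative e = 1 would give n = 3.\<close>
    with n(2) p(1) p3 \<open>e = 1 \<or> e = d\<close> show ?thesis by auto
  next
    case (Suc b)
    \<comment> \<open>If p^2 divides \<open>n\<close>, then \<open>p\<close> divides
      \<open>e\<close>, so e = d = p; cancelling \<open>p\<close> leaves p^b (p - 1) = 2, which
      forces p = 3 and b = 0.\<close>
    then have "p dvd 2 * e" using te by (metis dvd_triv_left mult.assoc power_Suc)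
    then have "p dvd e" using p(1) \<open>odd p\<close> by (metis prime_dvd_mult_iff primes_dvd_imp_eq two_is_prime_nat dvd_refl)
    with p(1) \<open>e = 1 \<or> e = d\<close> have "p dvd d" and ed: "e = d" using not_prime_unit by auto
    then have pd: "p = d" using p(1) d(1) primes_dvd_imp_eq by blast
    have "p * (p ^ b * (p - 1)) = p * 2" using te Suc ed pd by (simp add: mult_ac)
    then have two: "p ^ b * (p - 1) = 2" using p3 by simp
    then have "p - 1 \<le> 2" by (metis dvd_imp_le dvd_triv_right pos2)
    then have "p = 3" using p3 by simp
    moreover have "b = 0"
    proof (rule ccontr)
      assume "b \<noteq> 0"
      with two \<open>p = 3\<close> show False by (cases b) auto
    qed
    ultimately show ?thesis using n_eq Suc pd by simp
  qed
qed

text \<open>The number is the k-th power of a primitive 2n-th root of unity, so its order is 2 n /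
  gcd(k, 2 n); with \<open>k\<close> coprime to \<open>n\<close> this gcd is 2 or 1 according to the
  parity of \<open>k\<close>.\<close>

lemma cis_pi_fraction_primitive:
  assumes n: "n > 0" and k: "coprime k n"
  shows "cis (real k / real n * pi) ^ j = 1 \<longleftrightarrow> (if even k then n else 2 * n) dvd j"
proof -
  have "cis (real k / real n * pi) ^ j = cis (real (j * k) / real n * pi)"
    by (simp add: DeMoivre mult_ac)
  also have "\<dots> = 1 \<longleftrightarrow> 2 * n dvd j * k"
  proof
    assume "cis (real (j * k) / real n * pi) = 1"
    then have "cos (real (j * k) / real n * pi) = 1" by (simp add: complex_eq_iff)
    then obtain i :: int where i: "real (j * k) / real n * pi = of_int i * 2 * pi"
      using cos_one_2pi_int by auto
    then have "real (j * k) = of_int i * 2 * real n" using n by (simp add: field_simps)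
    then have "real_of_int (int (j * k)) = real_of_int (int (2 * n) * i)" by simp
    then have "int (j * k) = int (2 * n) * i" by (simp only: of_int_eq_iff)
    then have "int (2 * n) dvd int (j * k)" by simp
    then show "2 * n dvd j * k" by (simp only: of_nat_dvd_iff)
  next
    assume "2 * n dvd j * k"
    then obtain i where "j * k = 2 * n * i" by (auto simp: dvd_def)
    then have "real (j * k) / real n * pi = 2 * pi * real i" using n by (simp add: field_simps)
    then show "cis (real (j * k) / real n * pi) = 1" by (simp add: cis_multiple_2pi)
  qed
  also have "\<dots> \<longleftrightarrow> (if even k then n else 2 * n) dvd j"
  proof (cases "even k")
    case True
    then obtain k' where k': "k = 2 * k'" by auto
    then have "coprime n k'" using k by (simp add: coprime_commute)
    then have "n dvd j * k' \<longleftrightarrow> n dvd j" by (simp add: coprime_dvd_mult_left_iff)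
    then show ?thesis using True k' by (simp add: mult.left_commute)
  next
    case False
    then have "coprime (2 * n) k" using k by (simp add: coprime_commute coprime_left_2_iff_odd)
    then show ?thesis using False by (simp add: coprime_dvd_mult_left_iff)
  qed
  finally show ?thesis .
qed

theorem theorem0p4:
  fixes D u v :: "rat poly" and n :: nat and \<alpha> :: complex
  assumes "degree D > 0"
    and "fundamental_solution (map_poly of_rat D) (map_poly of_rat u) (map_poly of_rat v)"
    and "n > 3"
    and "order \<alpha> (pell_v_new (map_poly of_rat D) (map_poly of_rat u) (map_poly of_rat v) n) \<ge> 2"
    and "prime (rat_degree \<alpha>)" and "odd (rat_degree \<alpha>)"
  shows "(n = 2 * rat_degree \<alpha> + 1 \<and> prime n) \<or> (n = 9 \<and> rat_degree \<alpha> = 3)"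
proof -
  let ?D = "map_poly of_rat D :: complex poly" and ?u = "map_poly of_rat u :: complex poly"
    and ?v = "map_poly of_rat v :: complex poly"
  have "pell_v_new ?D ?u ?v n = (\<Prod>j\<in>totatives n. cos_factor ?u (real j / real n))"
    using assms(1-3) by (intro pell_v_new_eq_prod) (simp_all add: fundamental_solution_def)
  moreover have "poly (pell_v_new ?D ?u ?v n) \<alpha> = 0"
    using assms(4) by (simp add: order_root)
  ultimately obtain k where k: "k \<in> totatives n" "poly (cos_factor ?u (real k / real n)) \<alpha> = 0"
    by (auto simp: poly_prod)
  let ?z = "cis (real k / real n * pi)"
  have "rat_coeffs.ev u \<alpha> = cos (of_real (real k / real n * pi))"
    using k(2) by (simp add: cos_factor_def)
  also have "\<dots> = joukowski ?z"
    unfolding cos_of_real by (simp add: joukowski_def complex_eq_iff)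
  finally have "rat_coeffs.ev u \<alpha> = joukowski ?z" .
  then have mem: "joukowski ?z \<in> rat_adjoin \<alpha>"
    using complex_subfield_poly[OF complex_subfield_rat_adjoin mem_rat_adjoin] by metis
  define e where "e = rat_degree (joukowski ?z)"
  have "rat_degree \<alpha> > 0" using assms(5) prime_gt_0_nat by blast
  with mem have e: "e dvd rat_degree \<alpha>" unfolding e_def by (rule rat_degree_dvd)
  define N where "N = (if even k then n else 2 * n)"
  have cop: "coprime k n" using k(1) by (simp add: in_totatives_iff)
  have tot: "2 * e = totient N"
    unfolding e_def
    by (rule rat_degree_real_part_root_of_unity)
      (use cis_pi_fraction_primitive[OF _ cop] assms(3) in \<open>auto simp: N_def\<close>)
  \<comment> \<open>For even \<open>n\<close>, \<open>k\<close> is odd and N = 2 n, so e = totient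
    (2 n) / 2 = totient n, an even number that cannot divide an odd prime.\<close>
  have "odd n"
  proof
    assume "even n"
    then have "odd k" using cop by (metis coprime_common_divisor odd_one)
    with \<open>even n\<close> tot have "e = totient n" by (simp add: N_def totient_double)
    then have "even e" using totient_even[of n] assms(3) by simp
    with e assms(6) show False by (meson dvd_trans)
  qed
  \<comment> \<open>For odd \<open>n\<close> the totients of \<open>n\<close> and 2 n agree, so the
    parity of \<open>k\<close> no longer matters.\<close>
  then have "totient n = 2 * e" using tot by (simp add: N_def totient_double split: if_splits)
  with \<open>odd n\<close> assms(3) e assms(5,6) show ?thesis
    by (intro totient_eq_double_prime)
qed

end
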